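(* Let $U$ be a finite-dimensional Hilbert space over $\mathbb K\in\{\mathbb R,\mathbb C\}$ with dual $U'$, let $A:U\to U'$ and $P:U'\to U$ be linear operators, let $b\in U'$, let $u\in U$ be the solution of $Au=b$, put $E:=I-PA$ and $r(v):=b-Av$ for $v\in U$. Let $U_m\subset U$ be a subspace and let $v\in U_m$. Assume that there exists $\tau\in[0,1)$ such that $$\|u-\Pi_{U_m}u\|_U\le\tau\,\|u-v\|_U\quad\text{and}\quad \|E\|_{U_m,U_m}+\tau\,\|E\|_{U,U_m}<\sqrt{1-\tau^2}.$$ Then $$\frac{\|\Pi_{U_m}P\,r(v)\|_U}{1+\|E\|_{U_m,U_m}+\tau\|E\|_{U,U_m}}\ \le\ \|u-v\|_U\ \le\ \frac{\|\Pi_{U_m}P\,r(v)\|_U}{\sqrt{1-\tau^2}-\|E\|_{U_m,U_m}-\tau\|E\|_{U,U_m}} .$$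
   Context: $\Pi_{\tilde U}:U\to\tilde U$ denotes the orthogonal projector onto a subspace $\tilde U\subset U$. For a linear operator $G:U\to U$, $\|G\|_{op}=\max_{v\in U\setminus\{0\}}\|Gv\|_U/\|v\|_U$, and for subspaces $\tilde V,\tilde W\subset U$, $\|G\|_{\tilde V,\tilde W}:=\|\Pi_{\tilde W}G\,\Pi_{\tilde V}\|_{op}$ (a seminorm). In particular $\|G\|_{U,U_m}=\|\Pi_{U_m}G\|_{op}$. *)

theory Defs
  imports "HOL-Analysis.Operator_Norm" "HOL-Library.Function_Algebras"
begin

text \<open>
  The class below has exactly the fields of real and of complex numbers as models, up to
  isomorphism; see \<open>real_complex_field_cases\<close>.
\<close>

class real_complex_field = real_normed_field +
  fixes conjg :: "'a \<Rightarrow> 'a"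
  assumes conj_add: "conjg (x + y) = conjg x + conjg y"
    and mult_conj_scaleR: "x * conjg x = (norm x)\<^sup>2 *\<^sub>R 1"

instantiation real :: real_complex_field
begin
definition conjg_real_def [simp]: "conjg x = (x::real)"
instance by standard (auto simp: power2_eq_square)
end

instantiation complex :: real_complex_field
begin
definition conjg_complex_def [simp]: "conjg z = cnj z"
instance by standard (simp_all add: complex_norm_square[symmetric] scaleR_conv_of_real)
end

lemma mult_conj: "x * conjg x = of_real ((norm (x::'k::real_complex_field))\<^sup>2)"
  by (simp add: mult_conj_scaleR of_real_def)

lemma conj_0 [simp]: "conjg (0::'k::real_complex_field) = 0"
  using conj_add[of 0 "0::'k"] by simp

lemma conj_minus: "conjg (- x) = - conjg (x::'k::real_complex_field)"
  using conj_add[of x "- x"] by (simp add: eq_neg_iff_add_eq_0 add.commute)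

lemma conj_diff: "conjg (x - y) = conjg x - conjg (y::'k::real_complex_field)"
  using conj_add[of x "- y"] by (simp add: conj_minus)

lemma conj_mult: "conjg (x * y) = conjg x * conjg (y::'k::real_complex_field)"
proof (cases "x = 0 \<or> y = 0")
  case False
  have "(x * y) * conjg (x * y) = (x * conjg x) * (y * conjg y)"
    by (simp add: mult_conj norm_mult power_mult_distrib)
  then have "(x * y) * conjg (x * y) = (x * y) * (conjg x * conjg y)"
    by (simp add: ac_simps)
  with False show ?thesis by simp
qed auto

lemma conj_of_real [simp]: "conjg (of_real r) = (of_real r :: 'k::real_complex_field)"
  using mult_conj[of "of_real r :: 'k"] by (cases "r = 0") (auto simp: power2_eq_square)

lemma norm_conj [simp]: "norm (conjg x) = norm (x::'k::real_complex_field)"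
proof (cases "x = 0")
  case False
  have "norm x * norm (conjg x) = norm x * norm x"
    by (metis mult_conj norm_mult norm_of_real abs_power2 norm_power power2_eq_square real_norm_def abs_norm_cancel)
  with False show ?thesis by simp
qed simp

lemma conj_conj [simp]: "conjg (conjg x) = (x::'k::real_complex_field)"
proof (cases "x = 0")
  case False
  have "conjg x * conjg (conjg x) = conjg x * x"
    using mult_conj[of "conjg x"] mult_conj[of x] by (simp add: mult.commute)
  moreover have "conjg x \<noteq> 0" using False norm_conj[of x] by (metis norm_eq_zero)
  ultimately show ?thesis by simp
qed simp

lemma conj_fixed_imp_real:
  assumes "conjg x = (x::'k::real_complex_field)"
  shows "\<exists>r. x = of_real r"
proof -
  have "x * x = of_real (norm x) * of_real (norm x)"
    using mult_conj[of x] assms by (simp add: power2_eq_square)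
  then have "x = of_real (norm x) \<or> x = - of_real (norm x)"
    using square_eq_iff by blast
  then show ?thesis by (metis of_real_minus)
qed

definition scalar_iso :: "('a::real_complex_field \<Rightarrow> 'b::real_complex_field) \<Rightarrow> bool" where
  "scalar_iso h \<longleftrightarrow> bij h \<and> (\<forall>x y. h (x + y) = h x + h y) \<and> (\<forall>x y. h (x * y) = h x * h y)
     \<and> (\<forall>x. h (conjg x) = conjg (h x)) \<and> (\<forall>x. norm (h x) = norm x)"

lemma real_complex_field_cases:
  "(\<exists>h::real \<Rightarrow> 'k::real_complex_field. scalar_iso h) \<or> (\<exists>h::complex \<Rightarrow> 'k. scalar_iso h)"
proof (cases "\<forall>x::'k. conjg x = x")
  case True
  have "scalar_iso (of_real :: real \<Rightarrow> 'k)"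
    unfolding scalar_iso_def bij_def inj_def surj_def
    using conj_fixed_imp_real True by auto
  then show ?thesis by blast
next
  case False
  then obtain x0 :: 'k where "conjg x0 \<noteq> x0" by blast
  define w where "w = x0 - conjg x0"
  have w0: "w \<noteq> 0" using \<open>conjg x0 \<noteq> x0\<close> by (simp add: w_def)
  have cw: "conjg w = - w" by (simp add: w_def conj_diff)
  define j where "j = of_real (inverse (norm w)) * w"
  have cj: "conjg j = - j" by (simp add: j_def conj_mult cw del: of_real_inverse)
  have nj: "norm j = 1" using w0 by (simp add: j_def norm_mult norm_inverse)
  have jj: "j * j = -1"
    using mult_conj[of j] cj nj by (simp add: minus_equation_iff)
  define h where "h z = of_real (Re z) + of_real (Im z) * j" for z
  have ha: "h (x + y) = h x + h y" for x y by (simp add: h_def algebra_simps)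
  have hm: "h (x * y) = h x * h y" for x y
  proof -
    have "h x * h y = of_real (Re x) * of_real (Re y) + (of_real (Im x) * of_real (Im y)) * (j * j)
        + (of_real (Re x) * of_real (Im y) + of_real (Im x) * of_real (Re y)) * j"
      by (simp add: h_def algebra_simps)
    then show ?thesis by (simp add: jj) (simp add: h_def algebra_simps)
  qed
  have hc: "h (conjg x) = conjg (h x)" for x
    by (simp add: h_def conj_add conj_mult cj)
  have hr: "h (of_real r) = of_real r" for r by (simp add: h_def)
  have hn: "norm (h x) = norm x" for x
  proof -
    have "of_real ((norm (h x))\<^sup>2) = h x * conjg (h x)" by (simp only: mult_conj)
    also have "\<dots> = h (x * conjg x)" by (simp only: hm hc)
    also have "\<dots> = of_real ((norm x)\<^sup>2)" by (simp only: mult_conj hr)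
    finally have "(norm (h x))\<^sup>2 = (norm x)\<^sup>2" by (simp only: of_real_eq_iff)
    then show ?thesis by simp
  qed
  have "inj h"
  proof (rule injI)
    fix x y assume "h x = h y"
    moreover have "h x = h (x - y) + h y" using ha[of "x - y" y] by simp
    ultimately have "norm (x - y) = 0" using hn[of "x - y"] by simp
    then show "x = y" by simp
  qed
  moreover have "\<exists>z. x = h z" for x
  proof -
    have "conjg (x + conjg x) = x + conjg x" by (simp add: conj_add add.commute)
    then obtain a where a: "x + conjg x = of_real a" using conj_fixed_imp_real by blast
    have "conjg ((x - conjg x) * j) = (x - conjg x) * j"
      by (simp add: conj_mult conj_diff cj algebra_simps)
    then obtain t where t: "(x - conjg x) * j = of_real t" using conj_fixed_imp_real by blast
    have "x - conjg x = - ((x - conjg x) * (j * j))" by (simp add: jj)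
    also have "\<dots> = of_real (- t) * j" using t by (simp add: mult.assoc[symmetric])
    finally have "x + x = of_real a + of_real (- t) * j"
      using a by (metis add_diff_cancel_left' add.commute diff_add_cancel add.assoc add_diff_eq)
    moreover have "x = of_real (1/2) * (x + x)" by (simp add: field_simps)
    ultimately have "x = of_real (1/2) * (of_real a + of_real (- t) * j)" by metis
    then have "x = h (Complex (a/2) (- t/2))" by (simp add: h_def algebra_simps)
    then show ?thesis ..
  qed
  ultimately have "scalar_iso h"
    unfolding scalar_iso_def bij_def surj_def using ha hm hc hn by auto
  then show ?thesis by blast
qed

text \<open>
  The norm of the type is the one induced by the inner product \<open>ip\<close>, which makes \<open>ip\<close> positive
  definite, and its real scaling is the restriction of \<open>scale\<close>. Completeness is automatic in finite
  dimension.
\<close>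

locale finite_dim_hilbert_space = vector_space scale
  for scale :: "'k::real_complex_field \<Rightarrow> 'u::real_normed_vector \<Rightarrow> 'u" +
  fixes ip :: "'u \<Rightarrow> 'u \<Rightarrow> 'k"
  assumes scale_of_real: "scale (of_real r) x = r *\<^sub>R x"
    and ip_add_left: "ip (x + y) z = ip x z + ip y z"
    and ip_scale_left: "ip (scale c x) z = c * ip x z"
    and ip_conj_sym: "ip y x = conjg (ip x y)"
    and ip_self: "ip x x = of_real ((norm x)\<^sup>2)"
    and finite_dim: "\<exists>B. finite B \<and> span B = UNIV"

text \<open>
  The dual consists of linear (not antilinear) functionals, with the pointwise operations.
\<close>

definition dual :: "('k::field \<Rightarrow> 'u::ab_group_add \<Rightarrow> 'u) \<Rightarrow> ('u \<Rightarrow> 'k) set" where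
  "dual scale = {f. Vector_Spaces.linear scale (*) f}"

definition dual_scale :: "'k::field \<Rightarrow> ('u \<Rightarrow> 'k) \<Rightarrow> ('u \<Rightarrow> 'k)" where
  "dual_scale c f = (\<lambda>x. c * f x)"

lemma vector_space_dual_scale: "vector_space (dual_scale :: 'k::field \<Rightarrow> ('u \<Rightarrow> 'k) \<Rightarrow> _)"
  by standard (auto simp: dual_scale_def fun_eq_iff algebra_simps)

definition linear_to_dual ::
    "('k::field \<Rightarrow> 'u::ab_group_add \<Rightarrow> 'u) \<Rightarrow> ('u \<Rightarrow> 'u \<Rightarrow> 'k) \<Rightarrow> bool" where
  "linear_to_dual scale A \<longleftrightarrow>
     (\<forall>x. A x \<in> dual scale) \<and> Vector_Spaces.linear scale dual_scale A"

text \<open>Values of \<open>P\<close> outside \<open>dual scale\<close> are irrelevant and unconstrained.\<close>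

definition linear_from_dual ::
    "('k::field \<Rightarrow> 'u::ab_group_add \<Rightarrow> 'u) \<Rightarrow> (('u \<Rightarrow> 'k) \<Rightarrow> 'u) \<Rightarrow> bool" where
  "linear_from_dual scale P \<longleftrightarrow>
     (\<forall>f\<in>dual scale. \<forall>g\<in>dual scale. P (f + g) = P f + P g) \<and>
     (\<forall>c. \<forall>f\<in>dual scale. P (dual_scale c f) = scale c (P f))"

definition proj :: "('u::ab_group_add \<Rightarrow> 'u \<Rightarrow> 'k::zero) \<Rightarrow> 'u set \<Rightarrow> 'u \<Rightarrow> 'u" where
  "proj ip W x = (THE p. p \<in> W \<and> (\<forall>w\<in>W. ip (x - p) w = 0))"

text \<open>
  \<^const>\<open>onorm\<close> is the supremum of \<open>norm (G v) / norm v\<close> over all \<open>v\<close>, where the quotient at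
  \<open>v = 0\<close> is \<open>0\<close>. For linear \<open>G\<close> in finite dimension this is the maximum over \<open>v \<noteq> 0\<close>,
  and \<open>0\<close> on the zero space.
\<close>

definition op_seminorm ::
    "('u::real_normed_vector \<Rightarrow> 'u \<Rightarrow> 'k::zero) \<Rightarrow> 'u set \<Rightarrow> 'u set \<Rightarrow> ('u \<Rightarrow> 'u) \<Rightarrow> real" where
  "op_seminorm ip V W G = onorm (proj ip W \<circ> G \<circ> proj ip V)"

end

theory Submission imports Defs begin

text \<open>
  Put \<open>e = u - v\<close> and let \<open>Q\<close> be the orthogonal projector onto \<open>Um\<close>. Since \<open>A u = b\<close>, the
  preconditioned residual is \<open>P (r v) = P (A e) = e - E e\<close>, so that \<open>Q (P (r v)) = Q e - Q (E e)\<close>.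
  Splitting \<open>e = Q e + (e - Q e)\<close> in the second term gives
  \<open>\<parallel>Q (E e)\<parallel> \<le> (\<parallel>Q E Q\<parallel> + \<tau> \<parallel>Q E\<parallel>) \<parallel>e\<parallel>\<close>: because \<open>v\<close> lies in \<open>Um\<close>, the part
  \<open>e - Q e = u - Q u\<close> is exactly what the hypothesis bounds by \<open>\<tau> \<parallel>e\<parallel>\<close>. For the first term,
  Pythagoras and the same bound give \<open>sqrt (1 - \<tau>\<^sup>2) \<parallel>e\<parallel> \<le> \<parallel>Q e\<parallel> \<le> \<parallel>e\<parallel>\<close>. The two triangle
  inequalities for \<open>Q e - Q (E e)\<close> are then the two claimed bounds.

  Two facts about finite dimension carry the argument: the projector exists and is linear
  (\<open>proj_props\<close>, \<open>linear_proj\<close>), and linear maps are bounded (\<open>bounded_linear_if_linear\<close>), so that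
  the operator norms do dominate. Both come from orthonormal bases (\<open>orthonormal_basis_exists\<close>).
\<close>

section \<open>Orthogonality\<close>

context finite_dim_hilbert_space
begin

lemma ip_zero_left [simp]: "ip 0 z = 0"
  using ip_add_left[of 0 0 z] by simp

lemma ip_zero_right [simp]: "ip z 0 = 0"
  using ip_conj_sym[of z 0] by simp

lemma ip_add_right: "ip z (x + y) = ip z x + ip z y"
  by (metis ip_conj_sym ip_add_left conj_add)

lemma ip_scale_right: "ip z (scale c x) = conjg c * ip z x"
  by (metis ip_conj_sym ip_scale_left conj_mult)

lemma ip_diff_left: "ip (x - y) z = ip x z - ip y z"
  using ip_add_left[of "x - y" y z] by (simp add: eq_diff_eq)

lemma ip_sum_left: "ip (\<Sum>i\<in>S. f i) z = (\<Sum>i\<in>S. ip (f i) z)"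
  by (induction S rule: infinite_finite_induct) (auto simp: ip_add_left)

lemma ip_commute_0: "ip x y = 0 \<longleftrightarrow> ip y x = 0"
  by (metis ip_conj_sym conj_0)

lemma ip_self_eq_0 [simp]: "ip x x = 0 \<longleftrightarrow> x = 0"
  by (simp add: ip_self)

lemma norm_scale: "norm (scale c x) = norm c * norm x"
proof -
  have "(of_real ((norm (scale c x))\<^sup>2) :: 'k) = c * conjg c * ip x x"
    by (simp only: ip_self[symmetric] ip_scale_left ip_scale_right mult_ac)
  also have "\<dots> = of_real ((norm c)\<^sup>2 * (norm x)\<^sup>2)"
    by (simp only: ip_self mult_conj of_real_mult)
  finally have "(norm (scale c x))\<^sup>2 = (norm c * norm x)\<^sup>2"
    by (simp only: of_real_eq_iff power_mult_distrib)
  then show ?thesis by simp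
qed

lemma pythagoras:
  assumes "ip x y = 0"
  shows "(norm (x + y))\<^sup>2 = (norm x)\<^sup>2 + (norm y)\<^sup>2"
proof -
  have "ip y x = 0" using assms ip_commute_0 by blast
  then have "ip (x + y) (x + y) = ip x x + ip y y"
    using assms by (simp add: ip_add_left ip_add_right)
  then have "(of_real ((norm (x + y))\<^sup>2) :: 'k) = of_real ((norm x)\<^sup>2 + (norm y)\<^sup>2)"
    by (simp only: ip_self of_real_add)
  then show ?thesis by (simp only: of_real_eq_iff)
qed

lemma norm_ip_le_unit:
  assumes "norm e = 1"
  shows "norm (ip x e) \<le> norm x"
proof -
  define p where "p = scale (ip x e) e"
  have "ip (x - p) p = 0"
    by (simp add: p_def ip_diff_left ip_scale_left ip_scale_right ip_self assms)
  then have "(norm x)\<^sup>2 = (norm (x - p))\<^sup>2 + (norm p)\<^sup>2"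
    using pythagoras[of "x - p" p] by simp
  then have "(norm p)\<^sup>2 \<le> (norm x)\<^sup>2" by simp
  then have "norm p \<le> norm x" by (rule power2_le_imp_le) simp
  then show ?thesis by (simp add: p_def norm_scale assms)
qed

lemma orthogonal_span:
  assumes "\<And>e. e \<in> S \<Longrightarrow> ip x e = 0" and "w \<in> span S"
  shows "ip x w = 0"
proof -
  have "subspace {w. ip x w = 0}"
    by (auto intro!: subspaceI simp: ip_add_right ip_scale_right)
  then have "span S \<subseteq> {w. ip x w = 0}" using assms(1) by (intro span_minimal) auto
  with assms(2) show ?thesis by blast
qed

section \<open>Orthonormal bases and boundedness\<close>

definition orthonormal :: "'u set \<Rightarrow> bool" where
  "orthonormal S \<longleftrightarrow> (\<forall>e\<in>S. norm e = 1) \<and> (\<forall>e\<in>S. \<forall>f\<in>S. e \<noteq> f \<longrightarrow> ip e f = 0)"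

lemma orthonormal_residual:
  assumes "finite S" "orthonormal S" "w \<in> span S"
  shows "ip (x - (\<Sum>e\<in>S. scale (ip x e) e)) w = 0"
proof (rule orthogonal_span[OF _ assms(3)])
  fix f assume f: "f \<in> S"
  have "ip (\<Sum>e\<in>S. scale (ip x e) e) f = (\<Sum>e\<in>S. if e = f then ip x f else 0)"
    unfolding ip_sum_left
    by (rule sum.cong) (use assms(2) f in \<open>auto simp: ip_scale_left ip_self orthonormal_def\<close>)
  then show "ip (x - (\<Sum>e\<in>S. scale (ip x e) e)) f = 0"
    using assms(1) f by (simp add: ip_diff_left)
qed

lemma orthonormal_expansion:
  assumes "finite S" "orthonormal S" "x \<in> span S"
  shows "(\<Sum>e\<in>S. scale (ip x e) e) = x"
proof -
  let ?d = "x - (\<Sum>e\<in>S. scale (ip x e) e)"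
  have "?d \<in> span S"
    by (intro span_diff assms(3) span_sum span_scale span_base)
  then have "ip ?d ?d = 0" using orthonormal_residual assms(1,2) by blast
  then show ?thesis by (simp del: ip_self_eq_0 add: ip_self)
qed

text \<open>The step of the induction is the Gram--Schmidt process.\<close>

lemma gram_schmidt:
  assumes "finite B"
  shows "\<exists>S. finite S \<and> orthonormal S \<and> span S = span B"
  using assms
proof (induction B)
  case empty
  show ?case by (intro exI[of _ "{}"]) (simp add: orthonormal_def)
next
  case (insert a B)
  then obtain S where S: "finite S" "orthonormal S" "span S = span B" by blast
  define p where "p = (\<Sum>e\<in>S. scale (ip a e) e)"
  define d where "d = a - p"
  have p: "p \<in> span S" unfolding p_def by (intro span_sum span_scale span_base)
  have d: "ip d w = 0" if "w \<in> span S" for w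
    unfolding d_def p_def by (rule orthonormal_residual[OF S(1,2) that])
  have cong: "span (insert c S) = span (insert c B)" for c
    using S(3) by (simp add: span_insert)
  show ?case
  proof (cases "d = 0")
    case True
    then have "a \<in> span B" using p S(3) by (simp add: d_def)
    then show ?thesis using S span_redundant by metis
  next
    case False
    define k where "k = (of_real (inverse (norm d)) :: 'k)"
    define n where "n = scale k d"
    have nn: "norm n = 1"
      using False by (simp add: n_def norm_scale k_def norm_inverse)
    have n_orth: "ip n w = 0" if "w \<in> span S" for w
      using d[OF that] by (simp add: n_def ip_scale_left)
    have "orthonormal (insert n S)"
      using S(2) nn n_orth[OF span_base] ip_commute_0 by (auto simp: orthonormal_def)
    moreover have "span (insert n S) = span (insert a S)"
    proof (intro antisym span_minimal subspace_span insert_subsetI)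
      have p': "p \<in> span (insert c S)" for c
        using p span_mono[of S "insert c S"] by blast
      show "n \<in> span (insert a S)"
        unfolding n_def d_def by (intro span_scale span_diff p' span_base) simp
      have "scale (of_real (norm d)) n = d"
        using False by (simp add: n_def k_def flip: of_real_mult)
      then have "a = scale (of_real (norm d)) n + p" by (simp add: d_def)
      moreover have "scale (of_real (norm d)) n + p \<in> span (insert n S)"
        by (intro span_add span_scale p' span_base) simp
      ultimately show "a \<in> span (insert n S)" by simp
      show "S \<subseteq> span (insert a S)" "S \<subseteq> span (insert n S)"
        by (auto intro: span_base)
    qed
    ultimately show ?thesis using S(1) cong by (metis finite_insert)
  qed
qed

lemma orthonormal_basis_exists:
  assumes "subspace W"
  obtains S where "finite S" "orthonormal S" "span S = W"
proof -
  obtain B0 where B0: "finite B0" "span B0 = UNIV" using finite_dim by blast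
  obtain B where B: "B \<subseteq> W" "independent B" "W \<subseteq> span B"
    using maximal_independent_subset by blast
  have "finite B" using independent_span_bound[OF B0(1) B(2)] B0(2) by simp
  moreover have "span B = W"
    using B assms span_minimal by blast
  ultimately show ?thesis using gram_schmidt that by metis
qed

text \<open>
  In an orthonormal basis every coordinate of \<open>x\<close> is at most \<open>norm x\<close>, so the sum of the norms of
  the images of the basis vectors is a bound.
\<close>

lemma bounded_linear_if_linear:
  assumes "Vector_Spaces.linear scale scale T"
  shows "bounded_linear T"
proof -
  interpret T: Vector_Spaces.linear scale scale T by (rule assms)
  obtain S where S: "finite S" "orthonormal S" "span S = UNIV"
    using orthonormal_basis_exists[OF subspace_UNIV] by blast
  show ?thesis
  proof (rule bounded_linear_intro)
    show "T (x + y) = T x + T y" for x y by (rule T.add)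
    show "T (c *\<^sub>R x) = c *\<^sub>R T x" for c x
      by (metis T.scale scale_of_real)
    show "norm (T x) \<le> norm x * (\<Sum>e\<in>S. norm (T e))" for x
    proof -
      have "T x = T (\<Sum>e\<in>S. scale (ip x e) e)"
        using orthonormal_expansion[OF S(1,2)] S(3) by simp
      also have "\<dots> = (\<Sum>e\<in>S. scale (ip x e) (T e))" by (simp add: T.sum T.scale)
      also have "norm \<dots> \<le> (\<Sum>e\<in>S. norm x * norm (T e))"
        by (intro sum_norm_le)
          (use S(2) in \<open>auto simp: norm_scale orthonormal_def intro!: mult_right_mono norm_ip_le_unit\<close>)
      finally show ?thesis by (simp add: sum_distrib_left)
    qed
  qed
qed

section \<open>The orthogonal projector\<close>

lemma proj_eqI:
  assumes "subspace W" "p \<in> W" "\<And>w. w \<in> W \<Longrightarrow> ip (x - p) w = 0"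
  shows "proj ip W x = p"
  unfolding proj_def
proof (rule the_equality)
  fix q assume q: "q \<in> W \<and> (\<forall>w\<in>W. ip (x - q) w = 0)"
  have "p - q \<in> W" using assms(1,2) q by (simp add: subspace_diff)
  then have "ip (x - q) (p - q) - ip (x - p) (p - q) = 0" using assms(3) q by simp
  then have "ip (p - q) (p - q) = 0" by (simp only: ip_diff_left[symmetric]) simp
  then show "q = p" by simp
qed (use assms in auto)

lemma proj_props:
  assumes "subspace W"
  shows proj_in: "proj ip W x \<in> W"
    and proj_orthogonal: "w \<in> W \<Longrightarrow> ip (x - proj ip W x) w = 0"
proof -
  obtain S where S: "finite S" "orthonormal S" "span S = W"
    using orthonormal_basis_exists[OF assms] by blast
  define p where "p = (\<Sum>e\<in>S. scale (ip x e) e)"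
  have p: "p \<in> W" unfolding p_def S(3)[symmetric] by (intro span_sum span_scale span_base)
  have o: "ip (x - p) w = 0" if "w \<in> W" for w
    unfolding p_def using orthonormal_residual S that by blast
  have "proj ip W x = p" using proj_eqI[OF assms p o] .
  then show "proj ip W x \<in> W" "w \<in> W \<Longrightarrow> ip (x - proj ip W x) w = 0"
    using p o by auto
qed

lemma proj_UNIV [simp]: "proj ip UNIV x = x"
  by (rule proj_eqI) auto

lemma proj_fixes: "subspace W \<Longrightarrow> x \<in> W \<Longrightarrow> proj ip W x = x"
  by (rule proj_eqI) auto

lemma linear_proj:
  assumes W: "subspace W"
  shows "Vector_Spaces.linear scale scale (proj ip W)"
proof -
  have "proj ip W (x + y) = proj ip W x + proj ip W y" for x y
  proof (rule proj_eqI[OF W])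
    fix w assume "w \<in> W"
    then have "ip (x - proj ip W x) w + ip (y - proj ip W y) w = 0"
      using proj_orthogonal[OF W] by simp
    then show "ip (x + y - (proj ip W x + proj ip W y)) w = 0"
      by (simp add: ip_diff_left ip_add_left algebra_simps)
  qed (intro subspace_add W proj_in)
  moreover have "proj ip W (scale c x) = scale c (proj ip W x)" for c x
  proof (rule proj_eqI[OF W])
    fix w assume "w \<in> W"
    then show "ip (scale c x - scale c (proj ip W x)) w = 0"
      using proj_orthogonal[OF W]
      by (simp add: ip_scale_left flip: scale_right_diff_distrib)
  qed (intro subspace_scale W proj_in)
  ultimately show ?thesis
    using vector_space_axioms by (simp add: Vector_Spaces.linear_iff)
qed

lemma norm_proj_decomp:
  assumes "subspace W"
  shows "(norm x)\<^sup>2 = (norm (x - proj ip W x))\<^sup>2 + (norm (proj ip W x))\<^sup>2"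
  using pythagoras[OF proj_orthogonal[OF assms proj_in[OF assms, of x], of x]] by simp

lemma norm_proj_le:
  assumes "subspace W"
  shows "norm (proj ip W x) \<le> norm x"
proof (rule power2_le_imp_le)
  show "(norm (proj ip W x))\<^sup>2 \<le> (norm x)\<^sup>2"
    using norm_proj_decomp[OF assms, of x] by simp
qed simp

lemma norm_proj_ge:
  assumes W: "subspace W"
    and \<tau>: "0 \<le> \<tau>" "\<tau> < 1"
    and close: "norm (x - proj ip W x) \<le> \<tau> * norm x"
  shows "sqrt (1 - \<tau>\<^sup>2) * norm x \<le> norm (proj ip W x)"
proof (rule power2_le_imp_le)
  have "\<tau>\<^sup>2 \<le> 1" using \<tau> by (simp add: power_le_one)
  then have "(sqrt (1 - \<tau>\<^sup>2) * norm x)\<^sup>2 = (norm x)\<^sup>2 - (\<tau> * norm x)\<^sup>2"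
    by (simp add: power_mult_distrib algebra_simps)
  also have "\<dots> \<le> (norm x)\<^sup>2 - (norm (x - proj ip W x))\<^sup>2"
    using power_mono[OF close norm_ge_zero, of 2] by simp
  also have "\<dots> = (norm (proj ip W x))\<^sup>2"
    using norm_proj_decomp[OF W, of x] by simp
  finally show "(sqrt (1 - \<tau>\<^sup>2) * norm x)\<^sup>2 \<le> (norm (proj ip W x))\<^sup>2" .
qed simp

section \<open>The operator seminorm\<close>

lemma bounded_linear_compression:
  assumes "subspace V" "subspace W" "Vector_Spaces.linear scale scale G"
  shows "bounded_linear (proj ip W \<circ> G \<circ> proj ip V)"
  using assms linear_proj
  by (blast intro: bounded_linear_if_linear Vector_Spaces.linear_compose)

lemma op_seminorm_nonneg:
  assumes "subspace V" "subspace W" "Vector_Spaces.linear scale scale G"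
  shows "0 \<le> op_seminorm ip V W G"
  unfolding op_seminorm_def by (intro onorm_pos_le bounded_linear_compression assms)

lemma norm_le_op_seminorm:
  assumes "subspace V" "subspace W" "Vector_Spaces.linear scale scale G"
  shows "norm (proj ip W (G (proj ip V x))) \<le> op_seminorm ip V W G * norm x"
  using onorm[OF bounded_linear_compression[OF assms], of x]
  by (simp add: op_seminorm_def)

text \<open>
  The image of the component in \<open>W\<close> is measured by the seminorm of \<open>G\<close> on \<open>W\<close> alone; the seminorm
  on the whole space only enters weighted with the small remaining component.
\<close>

lemma norm_proj_image_le:
  assumes W: "subspace W" and G: "Vector_Spaces.linear scale scale G"
    and close: "norm (x - proj ip W x) \<le> \<tau> * norm x"
  shows "norm (proj ip W (G x)) \<le> (op_seminorm ip W W G + \<tau> * op_seminorm ip UNIV W G) * norm x"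
proof -
  let ?Q = "proj ip W"
  let ?d = "x - ?Q x"
  interpret Q: Vector_Spaces.linear scale scale ?Q by (rule linear_proj[OF W])
  interpret G: Vector_Spaces.linear scale scale G by (rule G)
  have "norm (?Q (G ?d)) \<le> op_seminorm ip UNIV W G * norm ?d"
    using norm_le_op_seminorm[OF subspace_UNIV W G, of ?d] by simp
  also have "\<dots> \<le> op_seminorm ip UNIV W G * (\<tau> * norm x)"
    by (intro mult_left_mono close op_seminorm_nonneg subspace_UNIV W G)
  finally have far: "norm (?Q (G ?d)) \<le> op_seminorm ip UNIV W G * (\<tau> * norm x)" .
  have "?Q (G x) = ?Q (G (?Q x)) + ?Q (G ?d)" by (simp add: G.diff Q.diff)
  then have "norm (?Q (G x)) \<le> norm (?Q (G (?Q x))) + norm (?Q (G ?d))"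
    by (simp add: norm_triangle_ineq)
  also have "\<dots> \<le> op_seminorm ip W W G * norm x + op_seminorm ip UNIV W G * (\<tau> * norm x)"
    using norm_le_op_seminorm[OF W W G, of x] far by (rule add_mono)
  finally show ?thesis by (simp add: algebra_simps)
qed

end

section \<open>The error estimate\<close>

theorem proposition4p6:
  fixes scale :: "'k::real_complex_field \<Rightarrow> 'u::real_normed_vector \<Rightarrow> 'u"
    and ip :: "'u \<Rightarrow> 'u \<Rightarrow> 'k"
    and A :: "'u \<Rightarrow> ('u \<Rightarrow> 'k)"
    and P :: "('u \<Rightarrow> 'k) \<Rightarrow> 'u"
    and b :: "'u \<Rightarrow> 'k"
    and u v :: 'u
    and E :: "'u \<Rightarrow> 'u"
    and r :: "'u \<Rightarrow> ('u \<Rightarrow> 'k)"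
    and Um :: "'u set"
    and \<tau> :: real
  assumes "finite_dim_hilbert_space scale ip"
    and "linear_to_dual scale A"
    and "linear_from_dual scale P"
    and "b \<in> dual scale"
    and "A u = b"
    and E_def: "E = (\<lambda>x. x - P (A x))"
    and r_def: "r = (\<lambda>x. b - A x)"
    and "module.subspace scale Um"
    and "v \<in> Um"
    and "0 \<le> \<tau>" and "\<tau> < 1"
    and "norm (u - proj ip Um u) \<le> \<tau> * norm (u - v)"
    and "op_seminorm ip Um Um E + \<tau> * op_seminorm ip UNIV Um E < sqrt (1 - \<tau>\<^sup>2)"
  shows "norm (proj ip Um (P (r v))) / (1 + op_seminorm ip Um Um E + \<tau> * op_seminorm ip UNIV Um E)
           \<le> norm (u - v) \<and>
         norm (u - v) \<le>
           norm (proj ip Um (P (r v))) /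
             (sqrt (1 - \<tau>\<^sup>2) - op_seminorm ip Um Um E - \<tau> * op_seminorm ip UNIV Um E)"
proof -
  interpret finite_dim_hilbert_space scale ip by fact
  let ?Q = "proj ip Um"
  define e where "e = u - v"
  define N where "N = op_seminorm ip Um Um E"
  define M where "M = op_seminorm ip UNIV Um E"
  have W: "subspace Um" by fact
  interpret Q: Vector_Spaces.linear scale scale ?Q by (rule linear_proj[OF W])
  have A_dual: "A x \<in> dual scale" for x
    using assms(2) by (simp add: linear_to_dual_def)
  have A_add: "A (x + y) = A x + A y" and A_scale: "A (scale c x) = dual_scale c (A x)" for x y c
    using assms(2) by (simp_all add: linear_to_dual_def Vector_Spaces.linear_iff)
  have PA_add: "P (A (x + y)) = P (A x) + P (A y)"
    and PA_scale: "P (A (scale c x)) = scale c (P (A x))" for x y c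
    using assms(3) A_dual by (simp_all add: linear_from_dual_def A_add A_scale)
  have E: "Vector_Spaces.linear scale scale E"
    using vector_space_axioms
    by (simp add: Vector_Spaces.linear_iff E_def PA_add PA_scale scale_right_diff_distrib)
  have "A e + A v = b"
    using \<open>A u = b\<close> A_add[of e v] by (simp add: e_def)
  then have "r v = A e" by (simp add: r_def flip: \<open>A e + A v = b\<close>)
  then have "P (r v) = e - E e" by (simp add: E_def)
  then have res: "?Q (P (r v)) = ?Q e - ?Q (E e)" by (simp add: Q.diff)
  have "e - ?Q e = u - ?Q u"
    by (simp add: e_def Q.diff proj_fixes[OF W \<open>v \<in> Um\<close>])
  then have close: "norm (e - ?Q e) \<le> \<tau> * norm e"
    using assms(12) by (simp only: e_def)
  have QE: "norm (?Q (E e)) \<le> (N + \<tau> * M) * norm e"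
    unfolding N_def M_def by (rule norm_proj_image_le[OF W E close])
  have NM: "0 \<le> N" "0 \<le> M"
    unfolding N_def M_def by (intro op_seminorm_nonneg subspace_UNIV W E)+
  have "norm (?Q (P (r v))) \<le> norm (?Q e) + norm (?Q (E e))"
    unfolding res by (rule norm_triangle_ineq4)
  also have "\<dots> \<le> norm e * (1 + N + \<tau> * M)"
    using norm_proj_le[OF W, of e] QE by (simp add: algebra_simps)
  finally have lower: "norm (?Q (P (r v))) \<le> norm e * (1 + N + \<tau> * M)" .
  have "norm e * (sqrt (1 - \<tau>\<^sup>2) - N - \<tau> * M) \<le> norm (?Q e) - norm (?Q (E e))"
    using norm_proj_ge[OF W \<open>0 \<le> \<tau>\<close> \<open>\<tau> < 1\<close> close] QE by (simp add: algebra_simps)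
  also have "\<dots> \<le> norm (?Q (P (r v)))"
    unfolding res by (rule norm_triangle_ineq2)
  finally have upper: "norm e * (sqrt (1 - \<tau>\<^sup>2) - N - \<tau> * M) \<le> norm (?Q (P (r v)))" .
  have "0 < 1 + N + \<tau> * M" using NM \<open>0 \<le> \<tau>\<close> by (simp add: add_pos_nonneg)
  moreover have "0 < sqrt (1 - \<tau>\<^sup>2) - N - \<tau> * M" using assms(13) by (simp add: N_def M_def)
  ultimately show ?thesis
    using lower upper
    by (simp add: pos_divide_le_eq pos_le_divide_eq flip: e_def N_def M_def)
qed

end
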